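(* Let $(r_n)_{n\in\mathbb{N}}$ be a sequence of positive real numbers, strictly increasing to infinity, satisfying $\sup_n|r_{n+1}-r_n|<+\infty$. Let $G=\mathbb{C}\setminus\{-r_j: j\in\mathbb{N}\}$. Then $b(G)=\frac12$.
   Context: Here $\mathbb{N}=\{1,2,3,\dots\}$. Let $\mathbb{D}$ be the open unit disk, and for a domain $D\subset\mathbb{C}$ let $\mathrm{Hol}(\mathbb{D},D)$ be the set of holomorphic functions $f:\mathbb{D}\to D$. For $p>0$ and $\alpha>-1$, the weighted Bergman space $A^p_\alpha$ is the set of holomorphic $f$ on $\mathbb{D}$ with $\int_{\mathbb{D}}|f(z)|^p(1-|z|)^\alpha\,dA(z)<+\infty$, where $dA$ is Lebesgue area measure. The Bergman number of a holomorphic function $f$ on $\mathbb{D}$ is $b(f):=\sup\left(\left\{\frac{p}{\alpha+2}: p>0,\ \alpha>-1,\ f\in A^p_\alpha\right\}\cup\{0\}\right)\in[0,+\infty]$. The Bergman number of a domain $D$ is $b(D):=\inf\{b(f): f\in\mathrm{Hol}(\mathbb{D},D)\}\in[0,+\infty]$. *)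

theory Defs
  imports "HOL-Complex_Analysis.Complex_Analysis"
begin

text \<open>
  Functions on the unit disk are represented by total functions of type
  \<^typ>\<open>complex \<Rightarrow> complex\<close>; every notion below depends only on their values on
  \<^term>\<open>ball (0::complex) 1\<close>.
\<close>

definition Hol_disk :: "complex set \<Rightarrow> (complex \<Rightarrow> complex) set" where
  "Hol_disk D = {f. f holomorphic_on ball 0 1 \<and> f ` ball 0 1 \<subseteq> D}"

text \<open>
  The Lebesgue measure on the complex plane is taken on the Borel sets; the
  integrand is Borel measurable on the disk, so completing it changes nothing. Only
  \<open>p > 0\<close> and \<open>\<alpha> > -1\<close> are of interest.
\<close>

definition weighted_bergman :: "real \<Rightarrow> real \<Rightarrow> (complex \<Rightarrow> complex) set" where
  "weighted_bergman p \<alpha> =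
     {f. f holomorphic_on ball 0 1 \<and>
         (\<integral>\<^sup>+z\<in>ball 0 1. ennreal (cmod (f z) powr p * (1 - cmod z) powr \<alpha>) \<partial>lborel) < \<infinity>}"

definition bergman_number :: "(complex \<Rightarrow> complex) \<Rightarrow> ereal" where
  "bergman_number f =
     Sup ({ereal (p / (\<alpha> + 2)) | p \<alpha>. p > 0 \<and> \<alpha> > -1 \<and> f \<in> weighted_bergman p \<alpha>} \<union> {0})"

definition domain_bergman_number :: "complex set \<Rightarrow> ereal" where
  "domain_bergman_number D = Inf {bergman_number f | f. f \<in> Hol_disk D}"

end

theory Submission
  imports Defs "HOL-Real_Asymp.Real_Asymp"
begin

text \<open>
  If a function on the disk grows at most like \<open>(1 - |z|) powr -\<beta>\<close>, then it lies in \<open>A\<^sup>p\<close>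
  with weight \<open>\<alpha> = p * \<beta>\<close> for every \<open>p\<close>; letting \<open>p \<rightarrow> \<infinity>\<close> its Bergman number is at least
  \<open>1 / \<beta>\<close>. So the lower bound amounts to growth of order \<open>2 + \<epsilon>\<close> for every holomorphic map into
  the domain. Were the invariant derivative of such maps not bounded by \<open>(4 + \<epsilon>) max S |f|\<close> for
  any \<open>S\<close>, a rescaled sequence of maps would converge, by the theorems of Schottky and Montel, to
  some \<open>g\<close> with \<open>|g 0| \<le> 1\<close> and \<open>|g' 0| \<ge> 4 + \<epsilon>\<close>. Since the gaps are bounded, the rescaled
  punctures become dense in the negative half-line, so by Hurwitz \<open>g\<close> maps into the slit plane, where
  the Schwarz lemma gives \<open>|g' 0| \<le> 4 |g 0|\<close>. The upper bound is attained by the Koebe-type map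
  \<open>((1 + z) / (1 - z))\<^sup>2\<close> onto the slit plane.
\<close>

section \<open>Derivative bound at the origin for maps into the slit plane\<close>

text \<open>The principal square root carries the slit plane into the right half-plane, where the
  Schwarz lemma bounds the derivative at 0 by twice the real part of the value; undoing the root by
  squaring contributes the other factor 2.\<close>

lemma slit_plane_deriv_le:
  assumes hol: "g holomorphic_on ball 0 1"
    and slit: "\<And>z. z \<in> ball 0 1 \<Longrightarrow> g z \<notin> \<real>\<^sub>\<le>\<^sub>0"
  shows "cmod (deriv g 0) \<le> 4 * cmod (g 0)"
proof -
  define s where "s = (\<lambda>z. csqrt (g z))"
  define a where "a = s 0"
  \<comment> \<open>Composition with the Cayley map of the right half-plane onto the disk that sends
    \<open>a = s 0\<close> to 0.\<close>
  define h where "h = (\<lambda>z. (s z - a) / (s z + cnj a))"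
  have hols: "s holomorphic_on ball 0 1"
    unfolding s_def using hol slit by (intro holomorphic_intros) auto
  have Re_s: "Re (s z) > 0" if "z \<in> ball 0 1" for z
  proof (rule ccontr)
    assume "\<not> Re (s z) > 0"
    then have "Re (s z) = 0" using csqrt_principal[of "g z"] by (auto simp: s_def)
    then have "(s z)\<^sup>2 \<in> \<real>\<^sub>\<le>\<^sub>0"
      by (simp add: complex_nonpos_Reals_iff Re_power2 Im_power2)
    then show False using slit[OF that] by (simp add: s_def)
  qed
  have Re_a: "Re a > 0" using Re_s[of 0] by (simp add: a_def)
  have den: "s z + cnj a \<noteq> 0" if "z \<in> ball 0 1" for z
    using Re_s[OF that] Re_a by (metis add_pos_pos cnj.sel(1) less_irrefl plus_complex.sel(1) zero_complex.sel(1))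
  have holh: "h holomorphic_on ball 0 1"
    unfolding h_def by (intro holomorphic_intros hols den)
  have h_lt: "cmod (h z) < 1" if "cmod z < 1" for z
  proof -
    have z: "z \<in> ball 0 1" using that by simp
    \<comment> \<open>The difference of the two sides is \<open>4 * Re (s z) * Re a\<close>.\<close>
    have "(cmod (s z - a))\<^sup>2 < (cmod (s z + cnj a))\<^sup>2"
      using mult_pos_pos[OF Re_s[OF z] Re_a]
      by (simp only: cmod_power2) (simp add: power2_eq_square algebra_simps)
    then have "cmod (s z - a) < cmod (s z + cnj a)" by (simp add: power2_less_imp_less)
    then show ?thesis using den[OF z] by (simp add: h_def norm_divide divide_simps)
  qed
  have "cmod (deriv h 0) \<le> 1"
    by (rule Schwarz_Lemma(2)[OF holh _ h_lt, of 0]) (auto simp: h_def a_def)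
  have ds: "(s has_field_derivative deriv s 0) (at 0)"
    using hols by (intro holomorphic_derivI[of _ "ball 0 1"]) auto
  have "(h has_field_derivative deriv s 0 / (a + cnj a)) (at 0)"
    unfolding h_def using den[of 0]
    by (auto intro!: derivative_eq_intros ds simp: a_def power2_eq_square)
  then have "deriv h 0 = deriv s 0 / (2 * of_real (Re a))"
    by (simp add: DERIV_imp_deriv complex_add_cnj)
  with \<open>cmod (deriv h 0) \<le> 1\<close> have "cmod (deriv s 0) \<le> 2 * Re a"
    using Re_a by (simp add: norm_divide norm_mult divide_simps)
  also have "\<dots> \<le> 2 * cmod a" using complex_Re_le_cmod[of a] by simp
  finally have le: "cmod (deriv s 0) \<le> 2 * cmod a" .
  have g_eq: "g z = (s z)\<^sup>2" for z by (simp add: s_def)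
  have "((\<lambda>z. (s z)\<^sup>2) has_field_derivative 2 * a * deriv s 0) (at 0)"
    by (auto intro!: derivative_eq_intros ds simp: a_def)
  then have "deriv g 0 = 2 * a * deriv s 0"
    using g_eq by (metis (no_types, lifting) DERIV_imp_deriv ext)
  moreover have "cmod a * cmod (deriv s 0) \<le> cmod a * (2 * cmod a)"
    using le by (intro mult_left_mono) auto
  ultimately show ?thesis
    using g_eq[of 0] by (simp add: norm_mult norm_power a_def power2_eq_square)
qed

section \<open>Compactness: limits of maps whose omitted values fill up the negative ray\<close>

text \<open>Schottky's theorem transferred to the open disk by a dilation. The point is that
  \<open>B\<close> depends only on \<open>r\<close> and \<open>s\<close>, so it serves a whole
  family of functions.\<close>

lemma Schottky_disk:
  assumes "0 < s" "s < 1"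
  obtains B where "0 \<le> B" 
    "\<And>h z. \<lbrakk>h holomorphic_on ball 0 1; cmod (h 0) \<le> r;
       \<And>w. w \<in> ball 0 1 \<Longrightarrow> h w \<noteq> 0 \<and> h w \<noteq> 1; cmod z \<le> s\<rbrakk> \<Longrightarrow> cmod (h z) \<le> B"
proof
  \<comment> \<open>Any radius strictly between \<open>s\<close> and 1 would do: the dilate by
    \<open>t\<close> is holomorphic on the closed disk, and points of modulus at most
    \<open>s\<close> correspond to points of modulus at most \<open>u < 1\<close>.\<close>
  define t where "t = (1 + s) / 2"
  define u where "u = s / t"
  have t: "0 < t" "t < 1" "s < t" using assms by (auto simp: t_def)
  have u: "0 < u" "u < 1" using t assms by (auto simp: u_def)
  define B where "B = exp (pi * exp (pi * (2 + 2 * r + 12 * u / (1 - u))))"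
  show "0 \<le> B" by (simp add: B_def)
  fix h z
  assume hol: "h holomorphic_on ball 0 1" and h0: "cmod (h 0) \<le> r"
    and omit: "\<And>w. w \<in> ball 0 1 \<Longrightarrow> h w \<noteq> 0 \<and> h w \<noteq> 1" and z: "cmod z \<le> s"
  have sub: "of_real t * w \<in> ball 0 1" if "w \<in> cball 0 1" for w :: complex
    using that t by (simp add: norm_mult) (metis mult_left_le less_le_trans not_le order.strict_trans1 less_imp_le)
  have "(h \<circ> (\<lambda>w. of_real t * w)) holomorphic_on cball 0 1"
    by (rule holomorphic_on_compose_gen[OF _ hol])
       (use sub in \<open>auto intro!: holomorphic_intros\<close>)
  then have "cmod ((h \<circ> (\<lambda>w. of_real t * w)) (z / of_real t)) \<le> B"
    unfolding B_def
  proof (rule Schottky)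
    show "cmod ((h \<circ> (\<lambda>w. of_real t * w)) 0) \<le> r" using h0 by simp
    show "\<not> ((h \<circ> (*) (complex_of_real t)) w = 0 \<or> (h \<circ> (*) (complex_of_real t)) w = 1)"
      if "w \<in> cball 0 1" for w using omit[OF sub[OF that]] by simp
    show "0 < u" "u < 1" by (fact u)+
    show "cmod (z / complex_of_real t) \<le> u"
      using z t by (simp add: u_def norm_divide divide_simps)
  qed
  then show "cmod (h z) \<le> B" using t by simp
qed

text \<open>The first term that reaches \<open>x\<close> exceeds it by at most one gap. If that term
  is already \<open>r 1\<close>, there is no previous term to compare with, and the summand
  \<open>r 1\<close> covers the error.\<close>

lemma ex_near_sequence:
  fixes r :: "nat \<Rightarrow> real"
  assumes pos: "\<And>n. n \<ge> 1 \<Longrightarrow> r n > 0"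
    and lim: "filterlim r at_top sequentially"
    and gap: "\<And>n. n \<ge> 1 \<Longrightarrow> \<bar>r (n + 1) - r n\<bar> \<le> K"
    and x: "0 \<le> x"
  shows "\<exists>j\<ge>1. \<bar>r j - x\<bar> \<le> K + r 1"
proof -
  have "\<forall>\<^sub>F n in sequentially. r n \<ge> x" using lim by (simp add: filterlim_at_top)
  then obtain n where n: "n \<ge> 1" "r n \<ge> x"
    by (metis eventually_sequentially max.cobounded1 max.cobounded2)
  define j where "j = (LEAST j. j \<ge> 1 \<and> r j \<ge> x)"
  have j: "j \<ge> 1" "r j \<ge> x"
    using LeastI[of "\<lambda>j. j \<ge> 1 \<and> r j \<ge> x" n] n by (auto simp: j_def)
  have K: "0 \<le> K" using gap[of 1] by linarith
  have "\<bar>r j - x\<bar> \<le> K + r 1"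
  proof (cases "j = 1")
    case True
    then show ?thesis using j x K by auto
  next
    case False
    then have "\<not> (j - 1 \<ge> 1 \<and> r (j - 1) \<ge> x)"
      using j unfolding j_def by (intro not_less_Least) (simp add: j_def)
    moreover have "j - 1 \<ge> 1" using False j by linarith
    ultimately show ?thesis using gap[of "j - 1"] j pos[of 1] by auto
  qed
  then show ?thesis using j by auto
qed

text \<open>The omitted values near -1 and -3 make the family locally bounded, so some subsequence
  converges. By Hurwitz the limit omits every point of the closed negative ray, and the slit-plane
  bound contradicts derivatives that all stay above \<open>4 + \<epsilon>\<close>.\<close>

lemma deriv_le_of_omitted_sequences:
  fixes g :: "nat \<Rightarrow> complex \<Rightarrow> complex"
  assumes hol: "\<And>n. g n holomorphic_on ball 0 1"
    and g0: "\<And>n. cmod (g n 0) \<le> 1"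
    and omit: "\<And>t. 0 \<le> t \<Longrightarrow>
      \<exists>a. a \<longlonglongrightarrow> - complex_of_real t \<and> (\<forall>n. \<forall>z\<in>ball 0 1. g n z \<noteq> a n)"
    and "\<epsilon> > 0"
  shows "\<exists>n. cmod (deriv (g n) 0) \<le> 4 + \<epsilon>"
proof (rule ccontr)
  assume "\<not> ?thesis"
  then have large: "cmod (deriv (g n) 0) > 4 + \<epsilon>" for n by (simp add: not_le)
  obtain a where a: "a \<longlonglongrightarrow> -1" "\<And>n z. z \<in> ball 0 1 \<Longrightarrow> g n z \<noteq> a n"
    using omit[of 1] by auto
  obtain b where b: "b \<longlonglongrightarrow> -3" "\<And>n z. z \<in> ball 0 1 \<Longrightarrow> g n z \<noteq> b n"
    using omit[of 3] by auto
  have "\<forall>\<^sub>F n in sequentially. dist (a n) (-1) < 1/2 \<and> dist (b n) (-3) < 1/2"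
    using tendstoD[OF a(1), of "1/2"] tendstoD[OF b(1), of "1/2"] by (simp add: eventually_conj)
  then obtain N where N: "\<And>n. n \<ge> N \<Longrightarrow> dist (a n) (-1) < 1/2 \<and> dist (b n) (-3) < 1/2"
    by (auto simp: eventually_sequentially)
  \<comment> \<open>The omitted pair may vary with the function, but the disks of radius 1/2 about
    -1 and -3 keep \<open>cmod (b - a)\<close> between 1 and 3, which is enough for a uniform
    bound.\<close>
  define H where "H = {h. h holomorphic_on ball 0 1 \<and> cmod (h 0) \<le> 1 \<and>
    (\<exists>a b. dist a (-1) < 1/2 \<and> dist b (-3) < 1/2 \<and> (\<forall>z\<in>ball 0 1. h z \<noteq> a \<and> h z \<noteq> b))}"
  have gH: "range (\<lambda>n. g (n + N)) \<subseteq> H"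
  proof (intro image_subsetI)
    show "g (n + N) \<in> H" for n
      unfolding H_def using hol g0 N[of "n + N"] a(2) b(2)
      by (intro CollectI conjI exI[of _ "a (n + N)"] exI[of _ "b (n + N)"]) auto
  qed
  have bounded: "\<exists>B. \<forall>h\<in>H. \<forall>z\<in>K. cmod (h z) \<le> B" if K: "compact K" "K \<subseteq> ball 0 1" for K
  proof -
    obtain s where s: "0 < s" "s < 1" "K \<subseteq> cball 0 s"
    proof (cases "K = {}")
      case True
      then show ?thesis using that[of "1/2"] by simp
    next
      case False
      then obtain w where w: "w \<in> K" "\<And>z. z \<in> K \<Longrightarrow> cmod z \<le> cmod w"
        using continuous_attains_sup[OF K(1) _ continuous_on_norm_id] by auto
      \<comment> \<open>The maximum with 1/2 keeps the radius positive when \<open>K\<close> is just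
        the origin.\<close>
      show ?thesis using w K(2) by (intro that[of "max (1/2) (cmod w)"]) (force simp: subset_iff)+
    qed
    obtain B where B: "0 \<le> B" "\<And>h z. \<lbrakk>h holomorphic_on ball 0 1; cmod (h 0) \<le> 5 / 2;
       \<And>w. w \<in> ball 0 1 \<Longrightarrow> h w \<noteq> 0 \<and> h w \<noteq> 1; cmod z \<le> s\<rbrakk> \<Longrightarrow> cmod (h z) \<le> B"
      by (rule Schottky_disk[OF s(1,2), of "5/2"]) blast
    have "cmod (h z) \<le> 2 + 3 * B" if h: "h \<in> H" and z: "z \<in> K" for h z
    proof -
      obtain a b where ab: "dist a (-1) < 1/2" "dist b (-3) < 1/2"
        and om: "\<And>z. z \<in> ball 0 1 \<Longrightarrow> h z \<noteq> a \<and> h z \<noteq> b"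
        and hh: "h holomorphic_on ball 0 1" "cmod (h 0) \<le> 1" using h by (auto simp: H_def)
      have na: "cmod a \<le> 3 / 2" and ba: "1 \<le> cmod (b - a)" "cmod (b - a) \<le> 3"
      proof -
        have "cmod a = cmod ((a + 1) - 1)" "cmod (b - a) = cmod (((b + 3) - (a + 1)) - 2)"
          "2 = cmod (((b + 3) - (a + 1)) - (b - a))" by (simp_all add: algebra_simps)
        moreover have "cmod (a + 1) < 1/2" "cmod (b + 3) < 1/2" using ab by (auto simp: dist_norm)
        ultimately show "cmod a \<le> 3 / 2" "1 \<le> cmod (b - a)" "cmod (b - a) \<le> 3"
          using norm_triangle_ineq4[of "a + 1" 1] norm_triangle_ineq4[of "b + 3" "a + 1"]
            norm_triangle_ineq4[of "(b + 3) - (a + 1)" 2]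
            norm_triangle_ineq4[of "(b + 3) - (a + 1)" "b - a"] by auto
      qed
      then have ne: "b - a \<noteq> 0" by auto
      \<comment> \<open>An affine change moves the omitted values to 0 and 1. The bound 5/2 at the
        origin is \<open>1 + 3/2\<close>, from \<open>cmod (h 0) \<le> 1\<close> and
        \<open>cmod a \<le> 3/2\<close>, divided by \<open>cmod (b - a) \<ge> 1\<close>.\<close>
      have "cmod ((h z - a) / (b - a)) \<le> B"
      proof (rule B(2)[where h = "\<lambda>z. (h z - a) / (b - a)"])
        show "(\<lambda>z. (h z - a) / (b - a)) holomorphic_on ball 0 1"
          using ne by (intro holomorphic_intros hh) auto
        have "cmod (h 0 - a) \<le> 5 / 2" using norm_triangle_ineq4[of "h 0" a] hh na by linarith
        also have "\<dots> \<le> 5 / 2 * cmod (b - a)" using ba by simp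
        finally show "cmod ((h 0 - a) / (b - a)) \<le> 5 / 2"
          using ne by (simp add: norm_divide divide_simps)
        show "(h w - a) / (b - a) \<noteq> 0 \<and> (h w - a) / (b - a) \<noteq> 1" if "w \<in> ball 0 1" for w
          using om[OF that] ne by (simp add: divide_simps)
        show "cmod z \<le> s" using s z by auto
      qed
      then have "cmod (h z - a) \<le> B * cmod (b - a)" using ne by (simp add: norm_divide divide_simps)
      also have "\<dots> \<le> B * 3" using ba B(1) by (intro mult_left_mono) auto
      finally show ?thesis using norm_triangle_ineq2[of "h z" a] na by linarith
    qed
    then show ?thesis by blast
  qed
  obtain G k where G: "G holomorphic_on ball 0 1" and k: "strict_mono (k :: nat \<Rightarrow> nat)"
    and ptw: "\<And>x. x \<in> ball 0 1 \<Longrightarrow> (\<lambda>n. g (k n + N) x) \<longlonglongrightarrow> G x"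
    and ul: "\<And>K. compact K \<Longrightarrow> K \<subseteq> ball 0 1 \<Longrightarrow> uniform_limit K ((\<lambda>n. g (n + N)) \<circ> k) G sequentially"
    by (rule Montel[of "ball 0 1" H, OF _ _ bounded gH]) (auto simp: H_def)
  have ul': "uniform_limit K (\<lambda>n. g (k n + N)) G sequentially" if "compact K" "K \<subseteq> ball 0 1" for K
    using ul[OF that] by (simp add: o_def)
  have kN: "filterlim (\<lambda>n. k n + N) sequentially sequentially"
    using filterlim_subseq[OF k] by (rule filterlim_compose[OF filterlim_add_const_nat_at_top])
  have "uniform_limit (ball 0 (1/2)) (\<lambda>n. g (k n + N)) G sequentially"
    by (rule uniform_limit_on_subset[OF ul'[of "cball 0 (1/2)"]]) auto
  then have "(\<lambda>n. deriv (g (k n + N)) 0) \<longlonglongrightarrow> deriv G 0"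
    by (rule deriv_complex_uniform_limit)
       (auto intro!: always_eventually holomorphic_on_subset[OF hol])
  then have "(\<lambda>n. cmod (deriv (g (k n + N)) 0)) \<longlonglongrightarrow> cmod (deriv G 0)"
    by (rule tendsto_norm)
  then have dG: "4 + \<epsilon> \<le> cmod (deriv G 0)"
    by (rule tendsto_lowerbound) (use large in \<open>auto intro!: always_eventually less_imp_le\<close>)
  have G0: "cmod (G 0) \<le> 1"
    by (rule tendsto_upperbound[OF tendsto_norm[OF ptw]]) (use g0 in auto)
  \<comment> \<open>Hurwitz's theorem requires a nonconstant limit; the lower bound on the
    derivative supplies it.\<close>
  have nonconst: "\<not> G constant_on ball 0 1"
  proof
    assume "G constant_on ball 0 1"
    then obtain c where c: "\<And>z. z \<in> ball 0 1 \<Longrightarrow> G z = c" by (auto simp: constant_on_def)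
    have "deriv G 0 = deriv (\<lambda>z. c) 0"
      by (rule deriv_cong_ev) (auto intro: eventually_nhds_in_open[THEN eventually_mono, of "ball 0 1"] c)
    then have "deriv G 0 = 0" by simp
    then show False using dG \<open>\<epsilon> > 0\<close> by simp
  qed
  have "G z \<notin> \<real>\<^sub>\<le>\<^sub>0" if z: "z \<in> ball 0 1" for z
  proof
    assume "G z \<in> \<real>\<^sub>\<le>\<^sub>0"
    then obtain t where t: "0 \<le> t" "G z = - of_real t"
      by (elim nonpos_Reals_cases) (metis minus_minus neg_0_le_iff_le of_real_minus)
    obtain a where a: "a \<longlonglongrightarrow> - complex_of_real t" "\<And>n z. z \<in> ball 0 1 \<Longrightarrow> g n z \<noteq> a n"
      using omit[OF t(1)] by auto
    \<comment> \<open>The functions \<open>g n - a n\<close> have no zeros and converge locally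
      uniformly to \<open>G + t\<close>.\<close>
    have "G z - (- of_real t) \<noteq> 0"
    proof (rule Hurwitz_no_zeros[where S = "ball 0 1" and \<F> = "\<lambda>n z. g (k n + N) z - a (k n + N)"
          and g = "\<lambda>z. G z - (- of_real t)"])
      show "(\<lambda>z. g (k n + N) z - a (k n + N)) holomorphic_on ball 0 1" for n
        by (intro holomorphic_intros hol)
      show "(\<lambda>z. G z - - complex_of_real t) holomorphic_on ball 0 1"
        by (intro holomorphic_intros G)
      have "(\<lambda>n. a (k n + N)) \<longlonglongrightarrow> - complex_of_real t"
        by (rule filterlim_compose[OF a(1) kN])
      then have "uniform_limit K (\<lambda>n z. a (k n + N)) (\<lambda>z. - complex_of_real t) sequentially" for K :: "complex set"
        unfolding uniform_limit_iff tendsto_iff by (auto elim: eventually_mono)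
      then show "uniform_limit K (\<lambda>n z. g (k n + N) z - a (k n + N)) (\<lambda>z. G z - - complex_of_real t)
          sequentially" if "compact K" "K \<subseteq> ball 0 1" for K
        by (intro uniform_limit_intros ul' that)
      show "\<not> (\<lambda>z. G z - - complex_of_real t) constant_on ball 0 1"
        using nonconst unfolding constant_on_def by (metis add_diff_cancel diff_add_cancel)
    qed (use a z in auto)
    then show False using t by simp
  qed
  from slit_plane_deriv_le[OF G this] have "cmod (deriv G 0) \<le> 4" using G0 by simp
  then show False using dG \<open>\<epsilon> > 0\<close> by simp
qed

section \<open>Rescaling: a derivative bound uniform over all maps into the punctured plane\<close>

text \<open>Rescaling a sequence of counterexamples with \<open>S = 1, 2, ...\<close> shrinks the
  gaps between punctures to 0, which is the situation of the preceding lemma. That \<open>S\<close>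
  is independent of \<open>f\<close> allows the bound to be applied later to \<open>f\<close>
  composed with disk automorphisms.\<close>

lemma deriv_bound_uniform:
  fixes r :: "nat \<Rightarrow> real"
  assumes pos: "\<And>n. n \<ge> 1 \<Longrightarrow> r n > 0"
    and lim: "filterlim r at_top sequentially"
    and gap: "\<And>n. n \<ge> 1 \<Longrightarrow> \<bar>r (n + 1) - r n\<bar> \<le> K"
    and "\<epsilon> > 0"
  obtains S where "S > 0"
    "\<And>f. f \<in> Hol_disk (UNIV - {- complex_of_real (r j) | j. j \<ge> 1}) \<Longrightarrow>
       cmod (deriv f 0) \<le> (4 + \<epsilon>) * max S (cmod (f 0))"
proof (rule ccontr)
  let ?D = "UNIV - {- complex_of_real (r j) | j. j \<ge> 1}"
  assume "\<not> thesis"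
  then have "\<forall>n. \<exists>f. f \<in> Hol_disk ?D \<and> \<not> cmod (deriv f 0) \<le> (4 + \<epsilon>) * max (real (Suc n)) (cmod (f 0))"
    using that of_nat_0_less_iff zero_less_Suc by blast
  from choice[OF this] obtain f where f: "\<And>n. f n \<in> Hol_disk ?D"
    and large: "\<And>n. \<not> cmod (deriv (f n) 0) \<le> (4 + \<epsilon>) * max (real (Suc n)) (cmod (f n 0))"
    by blast
  \<comment> \<open>Dividing by \<open>M n\<close> brings the value at 0 into the closed unit disk,
    while \<open>M n \<ge> n + 1\<close> forces the scale to infinity.\<close>
  define M where "M n = max (real (Suc n)) (cmod (f n 0))" for n
  define g where "g n z = f n z / of_real (M n)" for n z
  have M: "M n > 0" "M n \<ge> real (Suc n)" for n by (auto simp: M_def)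
  have hol: "f n holomorphic_on ball 0 1" for n using f[of n] by (auto simp: Hol_disk_def)
  have "\<exists>n. cmod (deriv (g n) 0) \<le> 4 + \<epsilon>"
  proof (rule deriv_le_of_omitted_sequences)
    show "g n holomorphic_on ball 0 1" for n
      unfolding g_def using M(1)[of n] by (intro holomorphic_intros hol) auto
    show "cmod (g n 0) \<le> 1" for n
      using M(1)[of n] by (simp add: g_def norm_divide divide_simps) (simp add: M_def)
    fix t :: real assume t: "0 \<le> t"
    \<comment> \<open>Some puncture lies within a fixed distance of \<open>- t * M n\<close>; after
      division by \<open>M n\<close> the error is O(1/n).\<close>
    have "\<exists>j\<ge>1. \<bar>r j - t * M n\<bar> \<le> K + r 1" for n
      using M(1)[of n] t by (intro ex_near_sequence pos lim gap) auto
    then obtain j where j: "\<And>n. j n \<ge> 1" "\<And>n. \<bar>r (j n) - t * M n\<bar> \<le> K + r 1" by metis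
    define a where "a n = - complex_of_real (r (j n) / M n)" for n
    have le: "norm (r (j n) / M n - t) \<le> (K + r 1) / real (Suc n)" for n
    proof -
      have "\<bar>r (j n) / M n - t\<bar> = \<bar>r (j n) - t * M n\<bar> / M n"
        using M(1)[of n] by (simp add: field_simps abs_divide)
      also have "\<dots> \<le> (K + r 1) / real (Suc n)"
        using j(2)[of n] M[of n] by (intro frac_le) auto
      finally show ?thesis by (simp only: real_norm_def)
    qed
    have lim0: "(\<lambda>n. (K + r 1) / real (Suc n)) \<longlonglongrightarrow> 0"
      using LIMSEQ_inverse_real_of_nat[THEN tendsto_mult_right_zero, of "K + r 1"]
      by (simp add: divide_inverse)
    have "(\<lambda>n. r (j n) / M n - t) \<longlonglongrightarrow> 0"
      by (rule Lim_null_comparison[OF always_eventually[OF allI[OF le]] lim0])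
    then have "(\<lambda>n. r (j n) / M n) \<longlonglongrightarrow> t" by (simp add: LIM_zero_iff)
    then have "a \<longlonglongrightarrow> - complex_of_real t"
      unfolding a_def[abs_def] by (intro tendsto_intros)
    moreover have "g n z \<noteq> a n" if "z \<in> ball 0 1" for n z
    proof -
      have "f n z \<in> ?D" using f[of n] that unfolding Hol_disk_def by blast
      then have "f n z \<noteq> - complex_of_real (r (j n))" using j(1)[of n] by blast
      then show ?thesis using M(1)[of n] by (simp add: g_def a_def divide_simps)
    qed
    ultimately show "\<exists>a. a \<longlonglongrightarrow> - complex_of_real t \<and> (\<forall>n. \<forall>z\<in>ball 0 1. g n z \<noteq> a n)" by blast
  qed fact
  then obtain n where n: "cmod (deriv (g n) 0) \<le> 4 + \<epsilon>" ..
  have "(f n has_field_derivative deriv (f n) 0) (at 0)"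
    using hol by (intro holomorphic_derivI[of _ "ball 0 1"]) auto
  then have "(g n has_field_derivative deriv (f n) 0 / of_real (M n)) (at 0)"
    unfolding g_def[abs_def] by (rule DERIV_cdivide)
  then have "deriv (g n) 0 = deriv (f n) 0 / of_real (M n)" by (rule DERIV_imp_deriv)
  then have "cmod (deriv (f n) 0) = cmod (deriv (g n) 0) * M n"
    using M(1)[of n] by (simp add: norm_divide)
  also have "\<dots> \<le> (4 + \<epsilon>) * M n" using n M(1)[of n] by (intro mult_right_mono) auto
  finally show False using large[of n] by (simp only: M_def)
qed

section \<open>From the derivative bound to a growth bound\<close>

text \<open>\<open>Hol_disk D\<close> is invariant under precomposition with disk automorphisms. The
  one that sends 0 to \<open>z\<close> has derivative \<open>1 - (cmod z)\<^sup>2\<close> at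
  0.\<close>

lemma deriv_bound_moebius:
  assumes bound: "\<And>f. f \<in> Hol_disk D \<Longrightarrow> cmod (deriv f 0) \<le> k * max S (cmod (f 0))"
    and f: "f \<in> Hol_disk D" and z: "cmod z < 1"
  shows "(1 - (cmod z)\<^sup>2) * cmod (deriv f z) \<le> k * max S (cmod (f z))"
proof -
  let ?\<phi> = "Moebius_function 0 (-z)"
  have hol: "f holomorphic_on ball 0 1" and ran: "f ` ball 0 1 \<subseteq> D" using f by (auto simp: Hol_disk_def)
  have sub: "?\<phi> ` ball 0 1 \<subseteq> ball 0 1" using z by (auto intro!: Moebius_function_norm_lt_1)
  have hol\<phi>: "?\<phi> holomorphic_on ball 0 1" using z by (intro Moebius_function_holomorphic) simp
  have \<phi>0: "?\<phi> 0 = z" by (simp add: Moebius_function_of_zero)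
  have "(f \<circ> ?\<phi>) holomorphic_on ball 0 1" by (rule holomorphic_on_compose_gen[OF hol\<phi> hol sub])
  then have "f \<circ> ?\<phi> \<in> Hol_disk D" using sub ran by (auto simp: Hol_disk_def)
  then have le: "cmod (deriv (f \<circ> ?\<phi>) 0) \<le> k * max S (cmod (f z))" using bound[of "f \<circ> ?\<phi>"] \<phi>0 by simp
  have "(?\<phi> has_field_derivative 1 - z * cnj z) (at 0)"
    unfolding Moebius_function_simple
    by (auto intro!: derivative_eq_intros simp: algebra_simps)
  moreover have "(f has_field_derivative deriv f z) (at (?\<phi> 0))"
    unfolding \<phi>0 using hol z by (intro holomorphic_derivI[of _ "ball 0 1"]) auto
  ultimately have "deriv (f \<circ> ?\<phi>) 0 = deriv f z * (1 - z * cnj z)"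
    by (intro DERIV_imp_deriv DERIV_chain)
  moreover have "1 - z * cnj z = of_real (1 - (cmod z)\<^sup>2)" by (metis complex_norm_square of_real_1 of_real_diff)
  moreover have "(cmod z)\<^sup>2 < 1" using z by (simp add: power_less_one_iff)
  ultimately have "cmod (deriv (f \<circ> ?\<phi>) 0) = (1 - (cmod z)\<^sup>2) * cmod (deriv f z)"
    by (simp add: norm_mult del: of_real_diff of_real_power)
  with le show ?thesis by simp
qed

text \<open>Integrating the invariant derivative bound along a radius: the logarithm of
  \<open>max S |f|\<close> grows at most at rate \<open>k / (1 - t\<^sup>2)\<close>, whose integral
  is \<open>k / 2 * ln ((1 + t) / (1 - t))\<close>. This is where the exponent \<open>k / 2\<close>
  arises.\<close>

lemma growth_of_deriv_bound:
  assumes bound: "\<And>f. f \<in> Hol_disk D \<Longrightarrow> cmod (deriv f 0) \<le> k * max S (cmod (f 0))"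
    and f: "f \<in> Hol_disk D" and S: "S > 0" and k: "k > 0"
  shows "\<exists>C. \<forall>z\<in>ball 0 1. cmod (f z) \<le> C * (1 - cmod z) powr (- (k / 2))"
proof -
  have hol: "f holomorphic_on ball 0 1" using f by (auto simp: Hol_disk_def)
  define A where "A = S\<^sup>2 + (cmod (f 0))\<^sup>2"
  have A: "A > 0" using S by (simp add: A_def add_pos_nonneg)
  have "cmod (f z) \<le> sqrt (A * 2 powr k) * (1 - cmod z) powr (- (k / 2))" if z: "z \<in> ball 0 1" for z
  proof -
    define \<rho> where "\<rho> = cmod z"
    have \<rho>: "0 \<le> \<rho>" "\<rho> < 1" using z by (auto simp: \<rho>_def)
    \<comment> \<open>The direction of the radius through \<open>z\<close>; at \<open>z = 0\<close>,
      where \<open>sgn\<close> vanishes, any unimodular number serves.\<close>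
    define \<omega> where "\<omega> = (if z = 0 then 1 else sgn z)"
    have \<omega>: "cmod \<omega> = 1" "z = of_real \<rho> * \<omega>"
      by (simp add: \<omega>_def norm_sgn) (simp add: \<omega>_def \<rho>_def sgn_eq)
    define v where "v t = f (of_real t * \<omega>)" for t :: real
    define v' where "v' t = deriv f (of_real t * \<omega>) * \<omega>" for t :: real
    \<comment> \<open>\<open>ln (S\<^sup>2 + |f|\<^sup>2)\<close> is a smooth substitute for \<open>2 * ln (max S |f|)\<close>.\<close>
    define F where "F t = ln (S\<^sup>2 + v t \<bullet> v t) - k * (ln (1 + t) - ln (1 - t))" for t
    have pos: "S\<^sup>2 + v t \<bullet> v t > 0" for t using S by (simp add: add_pos_nonneg)
    have "F \<rho> \<le> F 0"
    proof (rule DERIV_nonpos_imp_nonincreasing[OF \<rho>(1)])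
      fix t assume t: "0 \<le> t" "t \<le> \<rho>"
      have t1: "t < 1" using t \<rho> by simp
      have tw: "cmod (of_real t * \<omega>) < 1" using t t1 \<omega> by (simp add: norm_mult)
      have "((\<lambda>s::real. f (of_real s * \<omega>)) has_vector_derivative v' t) (at t)"
      proof -
        have "((\<lambda>s::real. of_real s * \<omega>) has_vector_derivative \<omega>) (at t)"
          by (auto intro!: derivative_eq_intros)
        moreover have "(f has_field_derivative deriv f (of_real t * \<omega>)) (at (of_real t * \<omega>))"
          using hol tw by (intro holomorphic_derivI[of _ "ball 0 1"]) auto
        ultimately show ?thesis
          using field_vector_diff_chain_at[of "\<lambda>s. of_real s * \<omega>"] by (simp add: o_def v'_def mult.commute)
      qed
      then have "(v has_derivative (\<lambda>h. h *\<^sub>R v' t)) (at t)"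
        by (simp add: has_vector_derivative_def v_def[abs_def])
      from has_derivative_inner[OF this this]
      have dv: "((\<lambda>t. v t \<bullet> v t) has_real_derivative 2 * (v t \<bullet> v' t)) (at t)"
        unfolding has_field_derivative_def
        by (rule has_derivative_eq_rhs) (auto simp: fun_eq_iff inner_commute algebra_simps)
      let ?F' = "2 * (v t \<bullet> v' t) / (S\<^sup>2 + v t \<bullet> v t) - k * (1 / (1 + t) + 1 / (1 - t))"
      have "(F has_real_derivative ?F') (at t)"
        unfolding F_def
      proof (intro DERIV_diff DERIV_cmult)
        show "((\<lambda>t. ln (S\<^sup>2 + v t \<bullet> v t)) has_real_derivative
            2 * (v t \<bullet> v' t) / (S\<^sup>2 + v t \<bullet> v t)) (at t)"
          using pos[of t] by (auto intro!: derivative_eq_intros dv)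
        have "((\<lambda>t. ln (1 + t) - ln (1 - t)) has_real_derivative 1 / (1 + t) - - 1 / (1 - t)) (at t)"
          using t t1 by (intro DERIV_diff) (auto intro!: derivative_eq_intros)
        then show "((\<lambda>t. ln (1 + t) - ln (1 - t)) has_real_derivative 1 / (1 + t) + 1 / (1 - t)) (at t)"
          by simp
      qed
      moreover have "?F' \<le> 0"
      proof -
        have t2: "1 - t\<^sup>2 > 0" using t t1 by (simp add: power_less_one_iff abs_square_less_1)
        have "v t \<bullet> v' t \<le> norm (v t) * norm (v' t)" by (rule norm_cauchy_schwarz)
        then have "(1 - t\<^sup>2) * (v t \<bullet> v' t) \<le> (1 - t\<^sup>2) * (norm (v t) * norm (v' t))"
          using t2 by (intro mult_left_mono) auto
        also have "\<dots> = norm (v t) * ((1 - t\<^sup>2) * norm (v' t))" by simp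
        also have "\<dots> \<le> norm (v t) * (k * max S (norm (v t)))"
          using deriv_bound_moebius[OF bound f tw] \<omega> t
          by (intro mult_left_mono) (auto simp: v_def v'_def norm_mult)
        also have "\<dots> = k * (norm (v t) * max S (norm (v t)))" by simp
        \<comment> \<open>The left side is the square of \<open>norm (v t)\<close> when the maximum
          is \<open>norm (v t)\<close>, and at most \<open>S\<^sup>2\<close> otherwise; this makes
          the smooth substitute for the maximum work.\<close>
        also have "norm (v t) * max S (norm (v t)) \<le> S\<^sup>2 + (norm (v t))\<^sup>2"
        proof (cases "S \<le> norm (v t)")
          case True
          then show ?thesis by (simp add: power2_eq_square)
        next
          case False
          then have "norm (v t) * S \<le> S * S" using S by (intro mult_right_mono) auto
          then show ?thesis using False by (simp add: power2_eq_square add_increasing2)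
        qed
        finally have "(1 - t\<^sup>2) * (v t \<bullet> v' t) \<le> k * (S\<^sup>2 + v t \<bullet> v t)"
          using k by (simp add: power2_norm_eq_inner)
        then have q1: "(v t \<bullet> v' t) / (S\<^sup>2 + v t \<bullet> v t) \<le> k / (1 - t\<^sup>2)"
          using pos[of t] t2 by (simp add: divide_simps mult.commute)
        have q2: "1 / (1 + t) + 1 / (1 - t) = 2 / (1 - t\<^sup>2)"
          using t t1 t2 by (simp add: divide_simps power2_eq_square) (simp add: algebra_simps)
        have q3: "2 * (v t \<bullet> v' t) / (S\<^sup>2 + v t \<bullet> v t) - k * (2 / (1 - t\<^sup>2))
            = 2 * ((v t \<bullet> v' t) / (S\<^sup>2 + v t \<bullet> v t) - k / (1 - t\<^sup>2))" by (simp add: right_diff_distrib)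
        show ?thesis unfolding q2 q3 by (rule mult_nonneg_nonpos) (use q1 in \<open>simp_all only: diff_le_0_iff_le zero_le_numeral\<close>)
      qed
      ultimately show "\<exists>y. (F has_real_derivative y) (at t) \<and> y \<le> 0" by blast
    qed
    then have "ln (S\<^sup>2 + (cmod (f z))\<^sup>2) \<le> ln A + k * (ln (1 + \<rho>) - ln (1 - \<rho>))"
      using \<omega> by (simp add: F_def v_def A_def power2_norm_eq_inner)
    also have "\<dots> \<le> ln A + k * (ln 2 - ln (1 - \<rho>))"
      using k \<rho> by (intro add_left_mono mult_left_mono diff_right_mono) auto
    also have "\<dots> = ln (A * 2 powr k * (1 - \<rho>) powr (-k))"
      using A \<rho> by (simp add: ln_mult ln_powr algebra_simps)
    finally have "S\<^sup>2 + (cmod (f z))\<^sup>2 \<le> A * 2 powr k * (1 - \<rho>) powr (-k)"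
      using A \<rho> S by (subst (asm) ln_le_cancel_iff) (auto intro!: add_pos_nonneg)
    then have "(cmod (f z))\<^sup>2 \<le> A * 2 powr k * (1 - \<rho>) powr (-k)"
      using zero_le_power2[of S] by linarith
    also have "\<dots> = (sqrt (A * 2 powr k) * (1 - \<rho>) powr (- (k / 2)))\<^sup>2"
      using A by (simp add: power_mult_distrib power2_eq_square[of "_ powr _"] powr_add[symmetric])
    finally have "cmod (f z) \<le> sqrt (A * 2 powr k) * (1 - \<rho>) powr (- (k / 2))"
      by (rule power2_le_imp_le) (use A in simp)
    then show ?thesis by (simp only: \<rho>_def)
  qed
  then show ?thesis by blast
qed

section \<open>From the growth bound to a lower bound for the Bergman number\<close>

text \<open>With weight exponent \<open>p * \<beta>\<close> the powers of \<open>1 - cmod z\<close>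
  cancel, so the integrand is bounded on a set of finite area.\<close>

lemma growth_imp_weighted_bergman:
  assumes hol: "f holomorphic_on ball 0 1"
    and growth: "\<And>z. z \<in> ball 0 1 \<Longrightarrow> cmod (f z) \<le> C * (1 - cmod z) powr (- \<beta>)"
    and p: "p > 0"
  shows "f \<in> weighted_bergman p (p * \<beta>)"
proof -
  have C: "0 \<le> C" using growth[of 0] order_trans[OF norm_ge_zero] by simp
  have "cmod (f z) powr p * (1 - cmod z) powr (p * \<beta>) \<le> C powr p" if z: "z \<in> ball 0 1" for z
  proof -
    have "cmod (f z) powr p \<le> (C * (1 - cmod z) powr (- \<beta>)) powr p"
      using growth[OF z] p by (intro powr_mono2) auto
    then have "cmod (f z) powr p * (1 - cmod z) powr (p * \<beta>)
      \<le> (C * (1 - cmod z) powr (- \<beta>)) powr p * (1 - cmod z) powr (p * \<beta>)"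
      by (intro mult_right_mono) auto
    also have "\<dots> = C powr p * (1 - cmod z) powr (- \<beta> * p + p * \<beta>)"
      using C by (simp only: powr_mult powr_powr powr_add mult.assoc)
    also have "\<dots> = C powr p" using z by (simp add: algebra_simps)
    finally show ?thesis .
  qed
  then have "(\<integral>\<^sup>+z\<in>ball 0 1. ennreal (cmod (f z) powr p * (1 - cmod z) powr (p * \<beta>)) \<partial>lborel)
    \<le> (\<integral>\<^sup>+z. ennreal (C powr p) * indicator (ball 0 1) (z::complex) \<partial>lborel)"
    by (intro nn_integral_mono) (auto simp: indicator_def intro!: ennreal_leI)
  also have "\<dots> = ennreal (C powr p) * emeasure lborel (ball (0::complex) 1)"
    by (rule nn_integral_cmult_indicator) simp
  also have "\<dots> < \<infinity>"
    using emeasure_lborel_ball_finite[of "0::complex" 1] by (simp add: ennreal_mult_less_top)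
  finally show ?thesis using hol by (simp add: weighted_bergman_def)
qed

lemma growth_imp_bergman_number_ge:
  assumes hol: "f holomorphic_on ball 0 1"
    and growth: "\<And>z. z \<in> ball 0 1 \<Longrightarrow> cmod (f z) \<le> C * (1 - cmod z) powr (- \<beta>)"
    and \<beta>: "\<beta> > 0"
  shows "ereal (1 / \<beta>) \<le> bergman_number f"
proof -
  \<comment> \<open>These are the quotients \<open>p / (\<alpha> + 2)\<close> for
    \<open>p = n + 1\<close> and \<open>\<alpha> = p * \<beta>\<close>.\<close>
  have "(\<lambda>n. real (Suc n) / (real (Suc n) * \<beta> + 2)) \<longlonglongrightarrow> 1 / \<beta>"
    using \<beta> by (real_asymp simp: field_simps)
  then have "(\<lambda>n. ereal (real (Suc n) / (real (Suc n) * \<beta> + 2))) \<longlonglongrightarrow> ereal (1 / \<beta>)"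
    by simp
  then show ?thesis
  proof (rule LIMSEQ_le_const2, intro exI allI impI)
    fix n :: nat
    have "f \<in> weighted_bergman (real (Suc n)) (real (Suc n) * \<beta>)"
      by (rule growth_imp_weighted_bergman[OF hol growth]) auto
    moreover have "real (Suc n) > 0" "real (Suc n) * \<beta> > -1"
      using \<beta> by (auto intro: less_trans[of _ 0])
    ultimately show "ereal (real (Suc n) / (real (Suc n) * \<beta> + 2)) \<le> bergman_number f"
      unfolding bergman_number_def by (intro Sup_upper) blast
  qed
qed

section \<open>The Koebe-type map and the upper bound\<close>

lemma power2_notin_nonpos_Reals:
  assumes "Re z > 0"
  shows "z\<^sup>2 \<notin> \<real>\<^sub>\<le>\<^sub>0"
  using assms by (auto simp: complex_nonpos_Reals_iff Re_power2 Im_power2)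

lemma Cayley_Re_pos:
  fixes z :: complex
  assumes "cmod z < 1"
  shows "Re ((1 + z) / (1 - z)) > 0"
proof -
  have "(cmod z)\<^sup>2 < 1" using assms by (simp add: power_less_one_iff)
  moreover have "z \<noteq> 1" using assms by auto
  ultimately show ?thesis
    by (simp add: Re_complex_div_gt_0 algebra_simps cmod_power2) (simp add: power2_eq_square)
qed

lemma Koebe_Hol_disk: "(\<lambda>z. ((1 + z) / (1 - z))\<^sup>2) \<in> Hol_disk (- \<real>\<^sub>\<le>\<^sub>0)"
proof -
  have "(\<lambda>z::complex. ((1 + z) / (1 - z))\<^sup>2) holomorphic_on ball 0 1"
    by (intro holomorphic_intros) auto
  then show ?thesis
    using power2_notin_nonpos_Reals[OF Cayley_Re_pos] by (auto simp: Hol_disk_def)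
qed

text \<open>On a disk of radius \<open>d / 2\<close> about \<open>1 - d\<close>, both
  \<open>1 - cmod z\<close> and \<open>cmod (1 - z)\<close> lie between \<open>d / 2\<close> and
  \<open>3 * d / 2\<close>, and \<open>cmod (1 + z) \<ge> 1 / 2\<close>. Hence the integrand is at
  least a constant times \<open>d powr (\<alpha> - 2 * p)\<close> there.\<close>

lemma Koebe_lower_bound:
  fixes z :: complex
  assumes p: "p > 0" and d: "0 < d" "d < 1" and z: "z \<in> ball (of_real (1 - d)) (d / 2)"
  shows "cmod z < 1"
    and "9 powr (-p) * 2 powr (- \<bar>\<alpha>\<bar>) * d powr (\<alpha> - 2 * p)
      \<le> cmod (((1 + z) / (1 - z))\<^sup>2) powr p * (1 - cmod z) powr \<alpha>"
proof -
  have dz: "cmod (z - of_real (1 - d)) < d / 2" using z by (simp add: dist_norm norm_minus_commute)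
  have "cmod (of_real (1 - d)) = 1 - d" using d by (simp only: norm_of_real abs_of_pos)
  then have low: "1 - cmod z > d / 2"
    using norm_triangle_ineq[of "z - of_real (1 - d)" "of_real (1 - d)"] dz by simp
  then show "cmod z < 1" using d by simp
  have m: "cmod (1 - z) < 3 * d / 2"
    using norm_triangle_ineq4[of "of_real d" "z - of_real (1 - d)"] dz d by simp
  have up: "1 - cmod z \<le> 3 * d / 2" using norm_triangle_ineq2[of 1 z] m by simp
  have "cmod (1 + z) \<ge> 1 / 2"
    using norm_triangle_ineq2[of 2 "1 - z"] m d by simp
  moreover have "cmod (1 - z) > 0" using \<open>cmod z < 1\<close> by auto
  ultimately have "cmod ((1 + z) / (1 - z)) \<ge> (1 / 2) / (3 * d / 2)"
    unfolding norm_divide using m by (intro frac_le) auto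
  then have "(1 / (3 * d))\<^sup>2 \<le> (cmod ((1 + z) / (1 - z)))\<^sup>2"
    using d by (intro power_mono) auto
  moreover have "(1 / (3 * d))\<^sup>2 = 1 / (9 * d\<^sup>2)" by (simp add: power_divide power_mult_distrib)
  ultimately have "1 / (9 * d\<^sup>2) \<le> cmod (((1 + z) / (1 - z))\<^sup>2)" by (simp only: norm_power)
  then have "(1 / (9 * d\<^sup>2)) powr p \<le> cmod (((1 + z) / (1 - z))\<^sup>2) powr p"
    using p by (intro powr_mono2) auto
  moreover have "(1 / (9 * d\<^sup>2)) powr p = 9 powr (-p) * d powr (- (2 * p))"
    using d by (simp add: powr_divide powr_mult powr_minus powr_powr[symmetric] divide_simps)
  \<comment> \<open>The sign of \<open>\<alpha>\<close> decides whether the lower bound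
    \<open>d / 2\<close> or the upper bound, relaxed to \<open>2 * d\<close>, is used;
    \<open>2 powr (- \<bar>\<alpha>\<bar>)\<close> fits both.\<close>
  moreover have "2 powr (- \<bar>\<alpha>\<bar>) * d powr \<alpha> \<le> (1 - cmod z) powr \<alpha>"
  proof (cases "\<alpha> \<ge> 0")
    case True
    then have "(d / 2) powr \<alpha> \<le> (1 - cmod z) powr \<alpha>"
      using low d by (intro powr_mono2) auto
    then show ?thesis using True d by (simp add: powr_divide powr_minus divide_simps)
  next
    case False
    then have "(2 * d) powr \<alpha> \<le> (1 - cmod z) powr \<alpha>"
      using up low d by (intro powr_mono2') auto
    then show ?thesis using False d by (simp add: powr_mult)
  qed
  ultimately have "9 powr (-p) * d powr (- (2 * p)) * (2 powr (- \<bar>\<alpha>\<bar>) * d powr \<alpha>)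
      \<le> cmod (((1 + z) / (1 - z))\<^sup>2) powr p * (1 - cmod z) powr \<alpha>"
    by (intro mult_mono) auto
  then show "9 powr (-p) * 2 powr (- \<bar>\<alpha>\<bar>) * d powr (\<alpha> - 2 * p)
      \<le> cmod (((1 + z) / (1 - z))\<^sup>2) powr p * (1 - cmod z) powr \<alpha>"
    using powr_add[of d \<alpha> "- (2 * p)"] by (simp add: mult_ac)
qed

text \<open>The disk about \<open>1 - d\<close> has area of order \<open>d\<^sup>2\<close>, so it
  alone contributes at least a constant times \<open>d powr (\<alpha> + 2 - 2 * p)\<close>. With a
  negative exponent this exceeds any finite integral as \<open>d\<close> tends to 0.\<close>

lemma bergman_exponents_Koebe:
  assumes p: "p > 0" and mem: "(\<lambda>z. ((1 + z) / (1 - z))\<^sup>2) \<in> weighted_bergman p \<alpha>"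
  shows "2 * p \<le> \<alpha> + 2"
proof (rule ccontr)
  assume contr: "\<not> ?thesis"
  define s where "s = 2 * p - \<alpha> - 2"
  have s: "s > 0" using contr by (simp add: s_def)
  let ?f = "\<lambda>z. cmod (((1 + z) / (1 - z))\<^sup>2) powr p * (1 - cmod z) powr \<alpha>"
  define I where "I = (\<integral>\<^sup>+z\<in>ball 0 1. ennreal (?f z) \<partial>lborel)"
  have "I < \<infinity>" using mem by (simp add: weighted_bergman_def I_def)
  then obtain x where x: "0 \<le> x" "I = ennreal x" by (cases I) auto
  define c where "c = 9 powr (-p) * 2 powr (- \<bar>\<alpha>\<bar>)"
  define v where "v = unit_ball_vol 2 / 4"
  have cv: "c > 0" "v > 0" by (simp_all add: c_def v_def)
  \<comment> \<open>The disk contributes at least \<open>c * v * d powr (- s)\<close>, where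
    \<open>v * d\<^sup>2\<close> is its area. Choosing \<open>d powr (- s) = y\<close> pushes this
    above \<open>x\<close>, and the final \<open>+ 1\<close> ensures \<open>y > 1\<close>, hence
    \<open>d < 1\<close>.\<close>
  define y where "y = (x + 1) / (c * v) + 1"
  have y: "y > 1" "c * v * y > x" using x cv by (simp_all add: y_def field_simps add_pos_pos)
  define d where "d = y powr (- 1 / s)"
  have d: "0 < d" "d < 1" using y s by (auto simp: d_def powr_less_one)
  have ds: "d powr (- s) = y" using y s by (simp add: d_def powr_powr)
  let ?B = "ball (complex_of_real (1 - d)) (d / 2)"
  have "ennreal (c * v * y) = ennreal (c * d powr (\<alpha> - 2 * p)) * ennreal (v * d\<^sup>2)"
  proof -
    have "c * v * y = c * v * d powr ((\<alpha> - 2 * p) + 2)" by (simp add: ds[symmetric] s_def algebra_simps)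
    also have "\<dots> = (c * d powr (\<alpha> - 2 * p)) * (v * d\<^sup>2)"
      using d by (simp add: powr_add)
    finally have eq: "c * v * y = (c * d powr (\<alpha> - 2 * p)) * (v * d\<^sup>2)" .
    show ?thesis unfolding eq using cv by (intro ennreal_mult) auto
  qed
  also have "ennreal (v * d\<^sup>2) = emeasure lborel ?B"
    using d by (simp add: emeasure_ball v_def power2_eq_square)
  also have "ennreal (c * d powr (\<alpha> - 2 * p)) * \<dots>
      = (\<integral>\<^sup>+z. ennreal (c * d powr (\<alpha> - 2 * p)) * indicator ?B z \<partial>lborel)"
    by (rule nn_integral_cmult_indicator[symmetric]) simp
  also have "\<dots> \<le> I"
    unfolding I_def
  proof (intro nn_integral_mono)
    fix z :: complex
    show "ennreal (c * d powr (\<alpha> - 2 * p)) * indicator ?B z \<le> ennreal (?f z) * indicator (ball 0 1) z"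
    proof (cases "z \<in> ?B")
      case True
      from Koebe_lower_bound[OF p d this] show ?thesis
        using True by (simp add: c_def ennreal_leI)
    qed simp
  qed
  finally have "c * v * y \<le> x" using x by (simp add: ennreal_le_iff)
  then show False using y by simp
qed

lemma bergman_number_Koebe_le: "bergman_number (\<lambda>z. ((1 + z) / (1 - z))\<^sup>2) \<le> ereal (1 / 2)"
  unfolding bergman_number_def
proof (rule Sup_least)
  fix x
  assume "x \<in> {ereal (p / (\<alpha> + 2)) | p \<alpha>. p > 0 \<and> \<alpha> > -1 \<and>
    (\<lambda>z. ((1 + z) / (1 - z))\<^sup>2) \<in> weighted_bergman p \<alpha>} \<union> {0}"
  then consider "x = 0" | p \<alpha> where "x = ereal (p / (\<alpha> + 2))" "p > 0" "\<alpha> > -1"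
    "(\<lambda>z. ((1 + z) / (1 - z))\<^sup>2) \<in> weighted_bergman p \<alpha>" by blast
  then show "x \<le> ereal (1 / 2)"
  proof cases
    case 2
    then show ?thesis using bergman_exponents_Koebe[OF 2(2,4)] by (simp add: field_simps)
  qed simp
qed

section \<open>The two bounds combined\<close>

theorem theorem1p4:
  fixes r :: "nat \<Rightarrow> real"
  assumes "\<And>n. n \<ge> 1 \<Longrightarrow> r n > 0"
    and "strict_mono_on {1..} r"
    and "filterlim r at_top sequentially"
    and "(SUP n\<in>{1..}. ereal \<bar>r (n + 1) - r n\<bar>) < \<infinity>"
  shows "domain_bergman_number (UNIV - {- complex_of_real (r j) | j. j \<ge> 1}) = ereal (1 / 2)"
proof (rule antisym)
  let ?D = "UNIV - {- complex_of_real (r j) | j. j \<ge> 1}"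
  let ?koebe = "\<lambda>z::complex. ((1 + z) / (1 - z))\<^sup>2"
  \<comment> \<open>All punctures lie on the slit, so the slit plane is contained in the domain and
    the Koebe-type map is a competitor for the infimum.\<close>
  have "- complex_of_real (r j) \<in> \<real>\<^sub>\<le>\<^sub>0" if "j \<ge> 1" for j
    using assms(1)[OF that] by (simp add: complex_nonpos_Reals_iff)
  then have "?koebe \<in> Hol_disk ?D" using Koebe_Hol_disk by (auto simp: Hol_disk_def)
  then have "domain_bergman_number ?D \<le> bergman_number ?koebe"
    unfolding domain_bergman_number_def by (intro Inf_lower) blast
  also have "\<dots> \<le> ereal (1 / 2)" by (rule bergman_number_Koebe_le)
  finally show "domain_bergman_number ?D \<le> ereal (1 / 2)" .

  define B where "B = (SUP n\<in>{1..}. ereal \<bar>r (n + 1) - r n\<bar>)"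
  have B: "ereal \<bar>r (n + 1) - r n\<bar> \<le> B" if "n \<ge> 1" for n
    unfolding B_def using that by (intro SUP_upper) simp
  moreover have "B \<noteq> \<infinity>" using assms(4) by (auto simp: B_def)
  moreover have "B \<noteq> - \<infinity>" using B[of 1] by auto
  ultimately obtain K where "B = ereal K" by (cases B) auto
  with B have gap: "\<bar>r (n + 1) - r n\<bar> \<le> K" if "n \<ge> 1" for n
    using that by simp
  have "ereal (1 / 2) \<le> bergman_number f" if f: "f \<in> Hol_disk ?D" for f
  proof (rule LIMSEQ_le_const2)
    have "(\<lambda>n. 1 / (2 + inverse (real (Suc n)))) \<longlonglongrightarrow> 1 / 2" by real_asymp
    then show "(\<lambda>n. ereal (1 / (2 + inverse (real (Suc n))))) \<longlonglongrightarrow> ereal (1 / 2)"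
      by (simp only: lim_ereal)
    \<comment> \<open>The derivative bound is taken with \<open>2 * \<epsilon>\<close>, because
      integration halves \<open>4 + 2 * \<epsilon>\<close> to the growth exponent
      \<open>2 + \<epsilon>\<close>. Then \<epsilon> runs through
      \<open>1 / (n + 1)\<close>.\<close>
    have "ereal (1 / (2 + \<epsilon>)) \<le> bergman_number f" if \<epsilon>: "\<epsilon> > 0" for \<epsilon>
    proof -
      obtain S where "S > 0" and S: "\<And>f. f \<in> Hol_disk ?D \<Longrightarrow>
          cmod (deriv f 0) \<le> (4 + 2 * \<epsilon>) * max S (cmod (f 0))"
        by (rule deriv_bound_uniform[OF assms(1,3) gap, of "2 * \<epsilon>"]) (use \<epsilon> in auto)
      from growth_of_deriv_bound[OF S f \<open>S > 0\<close>] \<epsilon>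
      obtain C where "\<forall>z\<in>ball 0 1. cmod (f z) \<le> C * (1 - cmod z) powr (- ((4 + 2 * \<epsilon>) / 2))"
        by fastforce
      moreover have "(4 + 2 * \<epsilon>) / 2 = 2 + \<epsilon>" by simp
      moreover have "f holomorphic_on ball 0 1" using f by (simp add: Hol_disk_def)
      ultimately show ?thesis
        using \<epsilon> by (intro growth_imp_bergman_number_ge[where C = C]) auto
    qed
    then show "\<exists>N. \<forall>n\<ge>N. ereal (1 / (2 + inverse (real (Suc n)))) \<le> bergman_number f" by simp
  qed
  then show "ereal (1 / 2) \<le> domain_bergman_number ?D"
    unfolding domain_bergman_number_def by (intro Inf_greatest) blast
qed

end
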